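(* Let $\mathcal{A}$ be a properly infinite von Neumann algebra acting on a Hilbert space $H$ and let $F\in\mathcal{A}$. Then $$\sigma_{eD}(F)=\bigcap\{\sigma_d(PF|_{\operatorname{Im}P}) : P\text{ is a finite projection in }\mathcal{A}\},$$ where $\sigma_d(PF|_{\operatorname{Im}P})=\{\lambda\in\mathbb{C}: (PF-\lambda I)|_{\operatorname{Im}P}\text{ is not onto }\operatorname{Im}P\}$.
   Context: Projections are orthogonal projections, and $I$ is the identity operator on $H$. A projection of $\mathcal{A}$ is finite if it is not Murray–von Neumann equivalent in $\mathcal{A}$ to any of its proper subprojections. For closed subspaces $M,N$ of $H$, $H=M\tilde\oplus N$ means $M\cap N=\{0\}$ and $M+N=H$ (not necessarily orthogonal). $\widetilde{\mathcal{K}\Phi}_-^+(\mathcal{A})$ is the set of all $T\in\mathcal{A}$ for which there exist projections $P,Q,S\in\mathcal{A}$ such that $T$ maps $(I-S)(H)$ isomorphically onto $(I-Q)(H)$, $H=(I-Q)(H)\tilde\oplus P(H)$, $P(H)\subseteq S(H)$, and $Q$ is finite. For $F\in\mathcal{A}$, $\sigma_{eD}(F)=\{\lambda\in\mathbb{C}: F-\lambda I\notin\widetilde{\mathcal{K}\Phi}_-^+(\mathcal{A})\}$.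
   Formalization: The intersection is taken over projections P in A whose complement I−P is finite, not over finite P: as written the claim fails, since P=0 is finite with empty σ_d, making the right side empty, while 0 lies in σ_eD(0) when H≠0. *)

theory Defs
  imports "HOL-Analysis.Analysis"
begin

text \<open>
  Complex Hilbert spaces. The inner product is linear in its first argument; positivity and
  definiteness follow from \<open>cinner_self\<close>. The topology is the norm topology inherited
  from \<^class>\<open>real_normed_vector\<close>.
\<close>

class complex_inner = real_normed_vector +
  fixes scaleC :: "complex \<Rightarrow> 'a \<Rightarrow> 'a" (infixr "*\<^sub>C" 75)
    and cinner :: "'a \<Rightarrow> 'a \<Rightarrow> complex"
  assumes scaleR_scaleC: "r *\<^sub>R x = complex_of_real r *\<^sub>C x"
    and scaleC_add_right: "c *\<^sub>C (x + y) = c *\<^sub>C x + c *\<^sub>C y"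
    and scaleC_add_left: "(c + d) *\<^sub>C x = c *\<^sub>C x + d *\<^sub>C x"
    and scaleC_scaleC: "c *\<^sub>C d *\<^sub>C x = (c * d) *\<^sub>C x"
    and cinner_commute: "cinner x y = cnj (cinner y x)"
    and cinner_add_left: "cinner (x + y) z = cinner x z + cinner y z"
    and cinner_scaleC_left: "cinner (c *\<^sub>C x) y = c * cinner x y"
    and cinner_self: "cinner x x = complex_of_real ((norm x)\<^sup>2)"

class chilbert_space = complex_inner + complete_space

definition bounded_clinear :: "('a::complex_inner \<Rightarrow> 'a) \<Rightarrow> bool" where
  "bounded_clinear T \<longleftrightarrow> bounded_linear T \<and> (\<forall>c x. T (c *\<^sub>C x) = c *\<^sub>C T x)"

definition is_adjoint :: "('a::complex_inner \<Rightarrow> 'a) \<Rightarrow> ('a \<Rightarrow> 'a) \<Rightarrow> bool" where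
  "is_adjoint T T' \<longleftrightarrow> (\<forall>x y. cinner (T x) y = cinner x (T' y))"

definition commutant :: "('a::complex_inner \<Rightarrow> 'a) set \<Rightarrow> ('a \<Rightarrow> 'a) set" where
  "commutant A = {T. bounded_clinear T \<and> (\<forall>S\<in>A. T \<circ> S = S \<circ> T)}"

text \<open>
  A von Neumann algebra is a self-adjoint set of operators that equals its double commutant
  (in particular it consists of bounded operators and is a unital algebra). Adjoints are unique,
  so the existential says that the adjoint of every element belongs to \<open>A\<close>.
\<close>

definition von_neumann_algebra :: "('a::chilbert_space \<Rightarrow> 'a) set \<Rightarrow> bool" where
  "von_neumann_algebra A \<longleftrightarrow>
     (\<forall>T\<in>A. \<exists>T'\<in>A. is_adjoint T T') \<and> commutant (commutant A) = A"

definition projection_in :: "('a::chilbert_space \<Rightarrow> 'a) set \<Rightarrow> ('a \<Rightarrow> 'a) \<Rightarrow> bool" where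
  "projection_in A P \<longleftrightarrow> P \<in> A \<and> P \<circ> P = P \<and> is_adjoint P P"

definition mvn_equivalent ::
    "('a::chilbert_space \<Rightarrow> 'a) set \<Rightarrow> ('a \<Rightarrow> 'a) \<Rightarrow> ('a \<Rightarrow> 'a) \<Rightarrow> bool" where
  "mvn_equivalent A P Q \<longleftrightarrow>
     (\<exists>V\<in>A. \<exists>V'\<in>A. is_adjoint V V' \<and> V' \<circ> V = P \<and> V \<circ> V' = Q)"

definition finite_projection :: "('a::chilbert_space \<Rightarrow> 'a) set \<Rightarrow> ('a \<Rightarrow> 'a) \<Rightarrow> bool" where
  "finite_projection A P \<longleftrightarrow> projection_in A P \<and>
     \<not> (\<exists>Q. projection_in A Q \<and> range Q \<subset> range P \<and> mvn_equivalent A P Q)"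

text \<open>The zero operator is always a finite central projection, hence the restriction to \<open>Z \<noteq> 0\<close>.\<close>

definition properly_infinite :: "('a::chilbert_space \<Rightarrow> 'a) set \<Rightarrow> bool" where
  "properly_infinite A \<longleftrightarrow>
     (\<forall>Z. finite_projection A Z \<and> Z \<in> commutant A \<longrightarrow> Z = (\<lambda>x. 0))"

definition compl :: "('a::ab_group_add \<Rightarrow> 'a) \<Rightarrow> 'a \<Rightarrow> 'a" where
  "compl P = (\<lambda>x. x - P x)"

definition is_direct_sum :: "'a::real_normed_vector set \<Rightarrow> 'a set \<Rightarrow> bool" where
  "is_direct_sum M N \<longleftrightarrow> M \<inter> N = {0} \<and> {x + y |x y. x \<in> M \<and> y \<in> N} = UNIV"

text \<open>
  The class written \<open>K\<Phi>\<close> with superscript + and subscript - and a tilde. An isomorphism of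
  closed subspaces is a linear homeomorphism; linearity is automatic because \<open>T \<in> A\<close>.
\<close>

definition KPhi_minus_plus :: "('a::chilbert_space \<Rightarrow> 'a) set \<Rightarrow> ('a \<Rightarrow> 'a) set" where
  "KPhi_minus_plus A = {T \<in> A. \<exists>P Q S.
     projection_in A P \<and> projection_in A Q \<and> projection_in A S \<and>
     (\<exists>T'. homeomorphism (range (compl S)) (range (compl Q)) T T') \<and>
     is_direct_sum (range (compl Q)) (range P) \<and>
     range P \<subseteq> range S \<and>
     finite_projection A Q}"

definition sigma_eD :: "('a::chilbert_space \<Rightarrow> 'a) set \<Rightarrow> ('a \<Rightarrow> 'a) \<Rightarrow> complex set" where
  "sigma_eD A F = {z. (\<lambda>x. F x - z *\<^sub>C x) \<notin> KPhi_minus_plus A}"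

text \<open>
  The defect spectrum of the compression of \<open>F\<close> to the image of \<open>P\<close>. Pitfall: it is empty for
  \<open>P = 0\<close>, and the zero projection is finite in every algebra. Intersecting these spectra over all
  finite \<open>P\<close> always gives the empty set; the intersection that computes
  \<open>sigma_eD\<close> ranges over the projections \<open>P\<close> of \<open>A\<close> whose complement \<open>I - P\<close> is finite.
\<close>

definition sigma_d_compression :: "('a::chilbert_space \<Rightarrow> 'a) \<Rightarrow> ('a \<Rightarrow> 'a) \<Rightarrow> complex set" where
  "sigma_d_compression P F = {z. (\<lambda>x. P (F x) - z *\<^sub>C x) ` range P \<noteq> range P}"

end

theory Submission
  imports Defs
begin

text \<open>
  Put \<open>T = F - z I\<close>. The theorem says that \<open>T\<close> belongs to the class \<open>KPhi_minus_plus A\<close> iff some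
  compression \<open>R T R\<close> is onto the range of \<open>R\<close>, where \<open>R\<close> is a projection of \<open>A\<close> with finite complement.

  If \<open>P\<close>, \<open>Q\<close>, \<open>S\<close> witness that \<open>T\<close> is in the class, then \<open>R = I - P\<close> works. It is elementary that the
  compression is onto. The finiteness of \<open>P\<close> comes from that of \<open>Q\<close>: a projection whose range is
  a complement, orthogonal or not, of the range of \<open>I - Q\<close> is Murray--von Neumann equivalent to \<open>Q\<close>
  (\<open>complementary_imp_equivalent\<close>), and finiteness is invariant under equivalence
  (\<open>finite_projection_equivalent\<close>).

  Conversely, if \<open>R T R\<close> is onto the range of \<open>R\<close>, then \<open>T\<close> is an isomorphism from the orthogonal
  complement of the kernel of \<open>R T R\<close> within the range of \<open>R\<close> onto a closed subspace that is
  complementary to the range of \<open>I - R\<close>. The projection onto this subspace lies in \<open>A\<close>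
  (\<open>range_projection_idempotent\<close>), and its complement is equivalent to the finite projection \<open>I - R\<close>, again
  by \<open>complementary_imp_equivalent\<close>.

  All operators that have to be found in \<open>A\<close> come from one construction, the polar decomposition of
  an operator \<open>G\<close> in \<open>A\<close> whose range is the range of a projection \<open>Q\<close> of \<open>A\<close>
  (\<open>surjection_right_inverse\<close>): it provides a right inverse of \<open>G\<close>, the projection onto the orthogonal
  complement of the kernel of \<open>G\<close>, and a partial isometry between that projection and \<open>Q\<close>.
  For surjections the operator \<open>G G\<^sup>* + I - Q\<close> is bounded below, by a uniform boundedness argument
  (\<open>adjoint_bounded_below\<close>), and its inverse square root is obtained in \<open>A\<close> from Banach's
  fixed point theorem (\<open>inverse_square_root\<close>).
\<close>

section \<open>Complex inner products\<close>

instance chilbert_space \<subseteq> banach ..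

lemma cinner_add_right: "cinner x (y + z) = cinner x y + cinner x (z :: 'a::complex_inner)"
  by (metis cinner_add_left cinner_commute complex_cnj_add)

lemma cinner_scaleC_right: "cinner x (c *\<^sub>C y) = cnj c * cinner x (y :: 'a::complex_inner)"
  by (metis cinner_scaleC_left cinner_commute complex_cnj_mult)

lemma cinner_diff_left: "cinner (x - y) z = cinner x z - cinner y (z :: 'a::complex_inner)"
  by (metis add_diff_cancel cinner_add_left diff_add_cancel)

lemma cinner_diff_right: "cinner x (y - z) = cinner x y - cinner x (z :: 'a::complex_inner)"
  by (metis add_diff_cancel cinner_add_right diff_add_cancel)

lemma cinner_scaleR_left: "cinner (r *\<^sub>R x) y = r * cinner x (y :: 'a::complex_inner)"
  by (simp add: scaleR_scaleC cinner_scaleC_left)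

lemma cinner_scaleR_right: "cinner x (r *\<^sub>R y) = r * cinner x (y :: 'a::complex_inner)"
  by (simp add: scaleR_scaleC cinner_scaleC_right)

lemma cinner_zero_left [simp]: "cinner 0 (x :: 'a::complex_inner) = 0"
  using cinner_diff_left[of x x x] by simp

lemma cinner_zero_right [simp]: "cinner (x :: 'a::complex_inner) 0 = 0"
  using cinner_diff_right[of x x x] by simp

lemmas cinner_simps =
  cinner_add_left cinner_add_right cinner_diff_left cinner_diff_right
  cinner_scaleC_left cinner_scaleC_right cinner_scaleR_left cinner_scaleR_right

lemma scaleC_scaleR: "c *\<^sub>C r *\<^sub>R x = r *\<^sub>R c *\<^sub>C (x :: 'a::complex_inner)"
  by (simp add: scaleR_scaleC scaleC_scaleC mult.commute)

lemma norm_scaleC: "norm (c *\<^sub>C x) = cmod c * norm (x :: 'a::complex_inner)"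
proof -
  have "complex_of_real ((norm (c *\<^sub>C x))\<^sup>2) = (c * cnj c) * complex_of_real ((norm x)\<^sup>2)"
    by (simp only: cinner_self[symmetric] cinner_scaleC_left cinner_scaleC_right mult.assoc
        mult.left_commute)
  then have "(norm (c *\<^sub>C x))\<^sup>2 = (cmod c * norm x)\<^sup>2"
    unfolding complex_norm_square[symmetric] power_mult_distrib
    using of_real_eq_iff by fastforce
  then show ?thesis
    by (simp add: power2_eq_iff_nonneg)
qed

lemma scaleC_zero_right [simp]: "c *\<^sub>C (0 :: 'a::complex_inner) = 0"
  using norm_scaleC[of c "0 :: 'a"] by simp

lemma bounded_linear_scaleC: "bounded_linear (\<lambda>x :: 'a::complex_inner. c *\<^sub>C x)"
  by (rule bounded_linear_intro[where K = "cmod c"])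
    (auto simp: scaleC_add_right scaleC_scaleR norm_scaleC mult.commute)

lemma Cauchy_Schwarz_cinner: "cmod (cinner x y) \<le> norm x * norm (y :: 'a::complex_inner)"
proof (cases "y = 0")
  case False
  define n where "n = complex_of_real ((norm y)\<^sup>2)"
  define c where "c = cinner x y / n"
  have n: "n \<noteq> 0" "cnj n = n" "cinner y y = n"
    using False by (simp_all add: n_def cinner_self)
  have "cinner (x - c *\<^sub>C y) (x - c *\<^sub>C y) =
      cinner x x - cnj c * cinner x y - c * cnj (cinner x y) + c * cnj c * n"
    using n(3) cinner_commute[of y x] by (simp add: cinner_simps algebra_simps)
  also have "\<dots> = cinner x x - cinner x y * cnj (cinner x y) / n"
    using n(1,2) by (simp add: c_def)
  finally have "complex_of_real ((norm (x - c *\<^sub>C y))\<^sup>2) =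
      complex_of_real ((norm x)\<^sup>2) - cinner x y * cnj (cinner x y) / complex_of_real ((norm y)\<^sup>2)"
    by (simp only: cinner_self n_def)
  also have "\<dots> = complex_of_real ((norm x)\<^sup>2 - (cmod (cinner x y))\<^sup>2 / (norm y)\<^sup>2)"
    by (simp add: complex_norm_square[symmetric])
  finally have "(norm (x - c *\<^sub>C y))\<^sup>2 = (norm x)\<^sup>2 - (cmod (cinner x y))\<^sup>2 / (norm y)\<^sup>2"
    using of_real_eq_iff by blast
  then have "(cmod (cinner x y))\<^sup>2 / (norm y)\<^sup>2 \<le> (norm x)\<^sup>2"
    using zero_le_power2[of "norm (x - c *\<^sub>C y)"] by linarith
  then have "(cmod (cinner x y))\<^sup>2 \<le> (norm x * norm y)\<^sup>2"
    using False by (simp add: field_simps)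
  then show ?thesis
    by (rule power2_le_imp_le) simp
qed simp

lemma bounded_linear_cinner_left: "bounded_linear (\<lambda>x :: 'a::complex_inner. cinner x y)"
  by (rule bounded_linear_intro[where K = "norm y"])
    (auto simp: cinner_simps Cauchy_Schwarz_cinner scaleR_conv_of_real)

lemma bounded_linear_cinner_right: "bounded_linear (\<lambda>y :: 'a::complex_inner. cinner x y)"
  by (rule bounded_linear_intro[where K = "norm x"])
    (auto simp: cinner_simps Cauchy_Schwarz_cinner scaleR_conv_of_real mult.commute[of _ "norm x"])

text \<open>The next two rules turn identities between operators into identities between their adjoints:
  the operators are moved to the other side of the inner product and simplified there.\<close>

lemma cinner_left_eqI:
  assumes "\<And>z. cinner x z = cinner y (z :: 'a::complex_inner)"
  shows "x = y"
proof -
  have "cinner (x - y) (x - y) = 0"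
    using assms[of "x - y"] by (simp only: cinner_diff_left diff_self)
  then show ?thesis by (simp add: cinner_self)
qed

lemma cinner_right_eqI:
  assumes "\<And>z. cinner z x = cinner z (y :: 'a::complex_inner)"
  shows "x = y"
  by (rule cinner_left_eqI) (metis assms cinner_commute)

lemma is_adjoint_sym: "is_adjoint T T' \<Longrightarrow> is_adjoint T' T"
  unfolding is_adjoint_def by (metis cinner_commute)

section \<open>Commutants as algebras of operators\<close>

lemma bounded_clinearD:
  assumes "bounded_clinear T"
  shows "bounded_linear T" "T (x + y) = T x + T y" "T (x - y) = T x - T y"
    "T (c *\<^sub>C x) = c *\<^sub>C T x" "T 0 = 0" "T (r *\<^sub>R x) = r *\<^sub>R T x"
proof -
  show "bounded_linear T" using assms by (simp add: bounded_clinear_def)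
  then interpret bounded_linear T .
  show "T (x + y) = T x + T y" "T (x - y) = T x - T y" "T 0 = 0" "T (r *\<^sub>R x) = r *\<^sub>R T x"
    by (simp_all add: add diff scaleR)
  show "T (c *\<^sub>C x) = c *\<^sub>C T x" using assms by (simp add: bounded_clinear_def)
qed

lemma commutantI:
  "bounded_clinear T \<Longrightarrow> (\<And>S x. S \<in> C \<Longrightarrow> T (S x) = S (T x)) \<Longrightarrow> T \<in> commutant C"
  unfolding commutant_def fun_eq_iff comp_def by blast

lemma commutantD:
  assumes "T \<in> commutant C"
  shows "bounded_clinear T" and "S \<in> C \<Longrightarrow> T (S x) = S (T x)"
proof -
  show "bounded_clinear T" using assms unfolding commutant_def by blast
  show "T (S x) = S (T x)" if "S \<in> C"
  proof -
    have "T \<circ> S = S \<circ> T" using assms that unfolding commutant_def by blast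
    then show ?thesis by (rule comp_eq_dest)
  qed
qed

lemma bounded_clinear_lincomb:
  assumes "bounded_clinear S" "bounded_clinear T"
  shows "bounded_clinear (\<lambda>x. S x + c *\<^sub>C T x)"
  using assms unfolding bounded_clinear_def
  by (auto intro!: bounded_linear_add bounded_linear_compose[OF bounded_linear_scaleC]
      simp: scaleC_add_right scaleC_scaleC mult.commute)

text \<open>The set \<open>C\<close> is assumed to consist of linear maps, since a commutant of arbitrary functions
  need not be closed under addition.\<close>

lemma commutant_lincomb:
  assumes S: "S \<in> commutant C" and T: "T \<in> commutant C"
    and C: "\<And>R. R \<in> C \<Longrightarrow> bounded_clinear R"
  shows "(\<lambda>x. S x + c *\<^sub>C T x) \<in> commutant C"
proof (rule commutantI)
  show "bounded_clinear (\<lambda>x. S x + c *\<^sub>C T x)"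
    by (intro bounded_clinear_lincomb commutantD(1)[OF S] commutantD(1)[OF T])
  fix R x assume "R \<in> C"
  then show "S (R x) + c *\<^sub>C T (R x) = R (S x + c *\<^sub>C T x)"
    by (simp only: commutantD(2)[OF S] commutantD(2)[OF T] bounded_clinearD[OF C])
qed

lemma commutant_comp:
  assumes S: "S \<in> commutant C" and T: "T \<in> commutant C"
  shows "(\<lambda>x. S (T x)) \<in> commutant C"
proof (rule commutantI)
  show "bounded_clinear (\<lambda>x. S (T x))"
    using commutantD(1)[OF S] commutantD(1)[OF T]
    by (auto simp: bounded_clinear_def intro: bounded_linear_compose)
  fix R x assume "R \<in> C"
  then show "S (T (R x)) = R (S (T x))"
    by (simp only: commutantD(2)[OF S] commutantD(2)[OF T])
qed

lemma commutant_id: "(\<lambda>x. x) \<in> commutant C"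
  by (intro commutantI) (auto simp: bounded_clinear_def)

section \<open>Inverse square roots\<close>

lemma commutant_inverse:
  assumes C: "\<And>R. R \<in> C \<Longrightarrow> bounded_clinear R"
    and Z: "Z \<in> commutant C" and U: "bounded_linear U"
    and ZU: "\<And>x. Z (U x) = x" and UZ: "\<And>x. U (Z x) = x"
  shows "U \<in> commutant C"
proof (rule commutantI)
  have "U (c *\<^sub>C x) = c *\<^sub>C U x" for c x
    by (metis ZU UZ bounded_clinearD(4)[OF commutantD(1)[OF Z]])
  with U show "bounded_clinear U" by (simp add: bounded_clinear_def)
  show "U (R x) = R (U x)" if "R \<in> C" for R x
    by (metis ZU UZ commutantD(2)[OF Z that])
qed

text \<open>\<open>U = I + Y U\<close> says that \<open>(I - Y) U = I\<close>, and its right-hand side is an \<open>r\<close>-contraction in \<open>U\<close>. That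
  \<open>U\<close> is also a left inverse follows from the injectivity of \<open>I - Y\<close>.\<close>

lemma Neumann_inverse:
  fixes Y :: "'a::chilbert_space \<Rightarrow> 'a"
  assumes C: "\<And>R. R \<in> C \<Longrightarrow> bounded_clinear R"
    and Y: "Y \<in> commutant C" "is_adjoint Y Y"
    and r: "\<And>x. norm (Y x) \<le> r * norm x" "0 \<le> r" "r < 1"
  obtains U where "U \<in> commutant C" "is_adjoint U U"
    "\<And>x. U x - Y (U x) = x" "\<And>x. U (x - Y x) = x"
proof -
  note bY = bounded_clinearD[OF commutantD(1)[OF Y(1)]]
  define y where "y = Blinfun Y"
  have y: "blinfun_apply y = Y" by (simp add: y_def bounded_linear_Blinfun_apply bY(1))
  have ny: "norm y \<le> r" by (rule norm_blinfun_bound) (simp_all add: y r)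
  have "\<exists>!u. id_blinfun + (y o\<^sub>L u) = u"
  proof (rule banach_fix_type[OF r(2,3)], intro allI)
    fix u v :: "'a \<Rightarrow>\<^sub>L 'a"
    have "(id_blinfun + (y o\<^sub>L u)) - (id_blinfun + (y o\<^sub>L v)) = y o\<^sub>L (u - v)"
      by (rule blinfun_eqI) (simp add: blinfun.bilinear_simps)
    then show "dist (id_blinfun + (y o\<^sub>L u)) (id_blinfun + (y o\<^sub>L v)) \<le> r * dist u v"
      by (simp add: dist_norm)
        (metis norm_blinfun_compose ny mult_right_mono norm_ge_zero order_trans)
  qed
  then obtain u where u: "id_blinfun + (y o\<^sub>L u) = u" by blast
  define U where "U = blinfun_apply u"
  have YU: "U x - Y (U x) = x" for x
    using arg_cong[OF u, of "\<lambda>f. blinfun_apply f x"]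
    by (simp add: blinfun.bilinear_simps U_def y algebra_simps)
  have inj: "x = 0" if "x - Y x = 0" for x
  proof -
    have "norm x \<le> r * norm x" using that r(1)[of x] by simp
    then have "(1 - r) * norm x \<le> 0" by (simp add: algebra_simps)
    with r(3) show ?thesis by (simp add: mult_le_0_iff)
  qed
  have bU: "bounded_linear U" by (simp add: U_def blinfun.bounded_linear_right)
  have UY: "U (x - Y x) = x" for x
  proof -
    have "(U (x - Y x) - x) - Y (U (x - Y x) - x) = 0"
      using YU[of "x - Y x"] by (simp add: bY(3) algebra_simps)
    from inj[OF this] show ?thesis by simp
  qed
  have Z: "(\<lambda>x. x - Y x) \<in> commutant C"
    using commutant_lincomb[OF commutant_id Y(1) C, where c = "-1"]
    by (simp add: scaleR_scaleC[of "-1", simplified, symmetric])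
  have "U \<in> commutant C"
    by (rule commutant_inverse[OF C Z bU]) (simp_all add: YU UY)
  moreover have "is_adjoint U U"
    unfolding is_adjoint_def
  proof (intro allI)
    fix v w
    have "cinner (U v) w = cinner (U v) (U w - Y (U w))" by (simp add: YU)
    also have "\<dots> = cinner (U v - Y (U v)) (U w)"
      using Y(2) by (simp add: cinner_simps is_adjoint_def)
    finally show "cinner (U v) w = cinner v (U w)" by (simp add: YU)
  qed
  ultimately show ?thesis using YU UY that by blast
qed

text \<open>\<open>Y = (X + Y\<^sup>2) / 2\<close> says that \<open>(I - Y)\<^sup>2 = I - X\<close>, so \<open>I - Y\<close> is a square root of
  \<open>I - X\<close>. On the ball of radius \<open>r < 1\<close> the right-hand side is an \<open>r\<close>-contraction, and being
  self-adjoint and commuting with \<open>C\<close> are closed conditions that it preserves.\<close>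

lemma square_root_fixed_point:
  fixes X :: "'a::chilbert_space \<Rightarrow> 'a"
  assumes C: "\<And>R. R \<in> C \<Longrightarrow> bounded_clinear R"
    and X: "X \<in> commutant C" "is_adjoint X X"
    and r: "\<And>x. norm (X x) \<le> r * norm x" "0 \<le> r" "r < 1"
  obtains Y where "Y \<in> commutant C" "is_adjoint Y Y"
    "\<And>x. norm (Y x) \<le> r * norm x" "\<And>x. X x + Y (Y x) = 2 *\<^sub>R Y x"
proof -
  define x where "x = Blinfun X"
  have x: "blinfun_apply x = X"
    by (simp add: x_def bounded_linear_Blinfun_apply bounded_clinearD(1)[OF commutantD(1)[OF X(1)]])
  have nx: "norm x \<le> r" by (rule norm_blinfun_bound) (simp_all add: x r)
  define S where "S = {y. norm y \<le> r \<and> blinfun_apply y \<in> commutant C \<and>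
    is_adjoint (blinfun_apply y) (blinfun_apply y)}"
  define \<Phi> where "\<Phi> y = (1/2) *\<^sub>R (x + (y o\<^sub>L y))" for y
  have S_eq: "S = {y. norm y \<le> r} \<inter> (\<Inter>c. \<Inter>v. {y. blinfun_apply y (c *\<^sub>C v) = c *\<^sub>C blinfun_apply y v})
      \<inter> (\<Inter>R\<in>C. \<Inter>v. {y. blinfun_apply y (R v) = R (blinfun_apply y v)})
      \<inter> (\<Inter>v. \<Inter>w. {y. cinner (blinfun_apply y v) w = cinner v (blinfun_apply y w)})"
    (is "_ = ?N \<inter> ?L \<inter> ?C \<inter> ?A")
  proof (rule set_eqI)
    fix y
    have "blinfun_apply y \<in> commutant C \<longleftrightarrow> y \<in> ?L \<and> y \<in> ?C"
    proof
      assume "blinfun_apply y \<in> commutant C"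
      from commutantD[OF this] show "y \<in> ?L \<and> y \<in> ?C"
        unfolding bounded_clinear_def by blast
    next
      assume "y \<in> ?L \<and> y \<in> ?C"
      then show "blinfun_apply y \<in> commutant C"
        by (intro commutantI) (auto simp: bounded_clinear_def blinfun.bounded_linear_right)
    qed
    moreover have "is_adjoint (blinfun_apply y) (blinfun_apply y) \<longleftrightarrow> y \<in> ?A"
      by (simp add: is_adjoint_def)
    ultimately show "y \<in> S \<longleftrightarrow> y \<in> ?N \<inter> ?L \<inter> ?C \<inter> ?A"
      by (simp only: S_def Int_iff mem_Collect_eq conj_assoc)
  qed
  have "closed S"
    unfolding S_eq
  proof (intro closed_Int closed_INT ballI closed_Collect_le closed_Collect_eq continuous_intros)
    show "continuous_on UNIV (\<lambda>y. c *\<^sub>C blinfun_apply y v)" for c and v :: 'a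
      by (intro bounded_linear.continuous_on[OF bounded_linear_scaleC] continuous_intros)
    show "continuous_on UNIV (\<lambda>y. R (blinfun_apply y v))" if "R \<in> C" for R v
      by (intro bounded_linear.continuous_on[OF bounded_clinearD(1)[OF C[OF that]]] continuous_intros)
    show "continuous_on UNIV (\<lambda>y. cinner (blinfun_apply y v) w)" for v w :: 'a
      by (intro bounded_linear.continuous_on[OF bounded_linear_cinner_left] continuous_intros)
    show "continuous_on UNIV (\<lambda>y. cinner v (blinfun_apply y w))" for v w :: 'a
      by (intro bounded_linear.continuous_on[OF bounded_linear_cinner_right] continuous_intros)
  qed
  then have "complete S" by (simp add: complete_eq_closed)
  have \<Phi>_apply: "blinfun_apply (\<Phi> y) = (\<lambda>v. (1/2) *\<^sub>R (X v + blinfun_apply y (blinfun_apply y v)))" for y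
    by (rule ext) (simp add: \<Phi>_def blinfun.bilinear_simps x)
  have \<Phi>_S: "\<Phi> y \<in> S" if "y \<in> S" for y
  proof -
    have y: "norm y \<le> r" "blinfun_apply y \<in> commutant C"
      and a: "cinner (blinfun_apply y v) w = cinner v (blinfun_apply y w)" for v w
      using that by (auto simp: S_def is_adjoint_def)
    have "norm (y o\<^sub>L y) \<le> r * r"
      by (rule order_trans[OF norm_blinfun_compose]) (intro mult_mono y r norm_ge_zero)
    moreover have "r * r \<le> r" using r by (simp add: mult_left_le)
    ultimately have "norm (\<Phi> y) \<le> r"
      using norm_triangle_ineq[of x "y o\<^sub>L y"] nx by (simp add: \<Phi>_def)
    moreover have "blinfun_apply (\<Phi> y) \<in> commutant C"
    proof -
      have h: "(\<lambda>v. (1/2) *\<^sub>R v) \<in> commutant C"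
        by (intro commutantI)
          (auto simp: bounded_clinear_def bounded_linear_scaleR_right scaleC_scaleR
            bounded_clinearD(6)[OF C])
      have "(\<lambda>v. X v + blinfun_apply y (blinfun_apply y v)) \<in> commutant C"
        using commutant_lincomb[OF X(1) commutant_comp[OF y(2) y(2)] C, where c = 1]
        by (simp add: scaleR_scaleC[of 1, simplified, symmetric])
      from commutant_comp[OF h this] show ?thesis by (simp add: \<Phi>_apply)
    qed
    moreover have "is_adjoint (blinfun_apply (\<Phi> y)) (blinfun_apply (\<Phi> y))"
      using X(2) by (simp add: is_adjoint_def \<Phi>_apply cinner_simps a)
    ultimately show ?thesis by (simp add: S_def)
  qed
  have lip: "dist (\<Phi> y) (\<Phi> z) \<le> r * dist y z" if "y \<in> S" "z \<in> S" for y z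
  proof -
    have le: "norm y \<le> r" "norm z \<le> r" using that by (auto simp: S_def)
    have "\<Phi> y - \<Phi> z = (1/2) *\<^sub>R ((y o\<^sub>L (y - z)) + ((y - z) o\<^sub>L z))"
      by (rule blinfun_eqI)
        (simp add: \<Phi>_apply blinfun.bilinear_simps scaleR_diff_right scaleR_add_right)
    moreover have "norm (y o\<^sub>L (y - z)) \<le> r * norm (y - z)"
      by (rule order_trans[OF norm_blinfun_compose]) (intro mult_right_mono le norm_ge_zero)
    moreover have "norm ((y - z) o\<^sub>L z) \<le> r * norm (y - z)"
      by (rule order_trans[OF norm_blinfun_compose])
        (simp add: mult.commute[of r] mult_left_mono le)
    ultimately show ?thesis
      using norm_triangle_ineq[of "y o\<^sub>L (y - z)" "(y - z) o\<^sub>L z"] by (simp add: dist_norm)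
  qed
  have "0 \<in> S"
  proof -
    have "(\<lambda>v :: 'a. 0 :: 'a) \<in> commutant C"
      by (rule commutantI) (simp_all add: bounded_clinear_def bounded_clinearD(5)[OF C])
    moreover have "blinfun_apply 0 = (\<lambda>v :: 'a. 0 :: 'a)" by (rule ext) simp
    ultimately show ?thesis using r(2) by (simp add: S_def is_adjoint_def)
  qed
  then have "\<exists>!y\<in>S. \<Phi> y = y"
    using \<Phi>_S lip by (intro Banach_fix[OF \<open>complete S\<close> _ r(2,3)]) auto
  then obtain y where y: "y \<in> S" "\<Phi> y = y" by blast
  show ?thesis
  proof (rule that)
    show "blinfun_apply y \<in> commutant C" "is_adjoint (blinfun_apply y) (blinfun_apply y)"
      using y(1) by (simp_all add: S_def)
    show "norm (blinfun_apply y v) \<le> r * norm v" for v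
      using y(1) norm_blinfun[of y v] mult_right_mono[of "norm y" r "norm v"]
      by (simp add: S_def)
    show "X v + blinfun_apply y (blinfun_apply y v) = 2 *\<^sub>R blinfun_apply y v" for v
      using arg_cong[OF y(2), of "\<lambda>f. 2 *\<^sub>R blinfun_apply f v"] by (simp add: \<Phi>_apply)
  qed
qed

text \<open>For small \<open>t > 0\<close> the norm of \<open>X = I - t D\<close> is below one, so that \<open>t D = I - X\<close> has an invertible
  square root; rescaling its inverse gives \<open>W = D\<^sup>-\<^sup>1\<^sup>/\<^sup>2\<close>. Working in the commutant of an arbitrary set \<open>C\<close>
  of operators yields at the same time that \<open>W\<close> lies in a von Neumann algebra (take its commutant
  for \<open>C\<close>) and that \<open>W\<close> commutes with a given operator (add that operator to \<open>C\<close>).\<close>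

lemma inverse_square_root:
  fixes D :: "'a::chilbert_space \<Rightarrow> 'a"
  assumes C: "\<And>R. R \<in> C \<Longrightarrow> bounded_clinear R"
    and D: "D \<in> commutant C" "is_adjoint D D"
    and c: "c > 0" "\<And>x. c * (norm x)\<^sup>2 \<le> Re (cinner (D x) x)"
  obtains W where "W \<in> commutant C" "is_adjoint W W"
    "\<And>x. W (W (D x)) = x" "\<And>x. W (D (W x)) = x" "\<And>x. D (W (W x)) = x"
proof -
  note bD = bounded_clinearD[OF commutantD(1)[OF D(1)]]
  obtain K0 where K0: "K0 > 0" "\<And>x. norm (D x) \<le> norm x * K0"
    using bounded_linear.pos_bounded[OF bD(1)] by blast
  define K where "K = K0 + c"
  have K: "0 < K" "c \<le> K" using K0(1) c(1) by (simp_all add: K_def)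
  have KD: "norm (D x) \<le> K * norm x" for x
  proof -
    have "K0 * norm x \<le> K * norm x" using c(1) by (intro mult_right_mono) (simp_all add: K_def)
    with K0(2)[of x] show ?thesis by (simp add: mult.commute)
  qed
  define t where "t = c / K\<^sup>2"
  define r where "r = sqrt (1 - (c / K)\<^sup>2)"
  have cK: "0 < c / K" "c / K \<le> 1" using K c(1) by (auto simp: field_simps)
  then have "0 < (c / K)\<^sup>2" "(c / K)\<^sup>2 \<le> 1" by (auto simp: power_le_one)
  then have r: "0 \<le> r" "r < 1" "r\<^sup>2 = 1 - (c / K)\<^sup>2" by (auto simp: r_def)
  have t: "t > 0" using c(1) K(1) by (simp add: t_def)
  define X where "X x = x - t *\<^sub>R D x" for x
  \<comment> \<open>\<open>t\<close> minimises the bound \<open>1 - 2tc + t\<^sup>2K\<^sup>2\<close> for the squared norm of \<open>I - tD\<close>.\<close>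
  have Xr: "norm (X x) \<le> r * norm x" for x
  proof -
    have "complex_of_real ((norm (X x))\<^sup>2) =
        cinner x x - t * (cinner (D x) x + cnj (cinner (D x) x)) + t\<^sup>2 * cinner (D x) (D x)"
      unfolding cinner_self[symmetric] cinner_commute[of "D x" x, symmetric]
      by (simp add: X_def cinner_simps algebra_simps power2_eq_square cinner_commute[of x "D x"])
    also have "\<dots> = complex_of_real
        ((norm x)\<^sup>2 - t * (2 * Re (cinner (D x) x)) + t\<^sup>2 * (norm (D x))\<^sup>2)"
      by (simp only: complex_add_cnj cinner_self of_real_add of_real_diff of_real_mult of_real_power)
    finally have "(norm (X x))\<^sup>2 = (norm x)\<^sup>2 - t * (2 * Re (cinner (D x) x)) + t\<^sup>2 * (norm (D x))\<^sup>2"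
      using of_real_eq_iff by blast
    also have "\<dots> \<le> (norm x)\<^sup>2 - t * (2 * (c * (norm x)\<^sup>2)) + t\<^sup>2 * (K * norm x)\<^sup>2"
    proof -
      have "t * (2 * (c * (norm x)\<^sup>2)) \<le> t * (2 * Re (cinner (D x) x))"
        using c(2)[of x] t by simp
      moreover have "t\<^sup>2 * (norm (D x))\<^sup>2 \<le> t\<^sup>2 * (K * norm x)\<^sup>2"
        by (intro mult_left_mono power_mono KD) auto
      ultimately show ?thesis by linarith
    qed
    also have "\<dots> = r\<^sup>2 * (norm x)\<^sup>2"
      using K(1) unfolding r(3) by (simp add: t_def field_simps power2_eq_square)
    finally have "(norm (X x))\<^sup>2 \<le> (r * norm x)\<^sup>2" by (simp add: power_mult_distrib)
    then show ?thesis by (rule power2_le_imp_le) (simp add: r)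
  qed
  have XC: "X \<in> commutant C"
    using commutant_lincomb[OF commutant_id D(1) C, where c = "complex_of_real (-t)"]
    unfolding scaleR_scaleC[symmetric] by (simp add: X_def[abs_def])
  have XX: "is_adjoint X X"
    using D(2) by (simp add: is_adjoint_def X_def cinner_simps)
  obtain Y where Y: "Y \<in> commutant C" "is_adjoint Y Y" "\<And>x. norm (Y x) \<le> r * norm x"
      "\<And>x. X x + Y (Y x) = 2 *\<^sub>R Y x"
    using square_root_fixed_point[OF C XC XX Xr r(1,2)] by blast
  obtain U where U: "U \<in> commutant C" "is_adjoint U U"
      "\<And>x. U x - Y (U x) = x" "\<And>x. U (x - Y x) = x"
    using Neumann_inverse[OF C Y(1,2,3) r(1,2)] by blast
  note bY = bounded_clinearD[OF commutantD(1)[OF Y(1)]]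
  note bU = bounded_clinearD[OF commutantD(1)[OF U(1)]]
  define Z where "Z x = x - Y x" for x
  have UZ: "U (Z x) = x" "Z (U x) = x" for x using U by (simp_all add: Z_def)
  have ZZ: "Z (Z x) = t *\<^sub>R D x" for x
    using Y(4)[of x] by (simp add: Z_def X_def bY algebra_simps scaleR_2)
  define W where "W x = sqrt t *\<^sub>R U x" for x
  have "(\<lambda>v. sqrt t *\<^sub>R v) \<in> commutant C"
    by (intro commutantI)
      (auto simp: bounded_clinear_def bounded_linear_scaleR_right scaleC_scaleR
        bounded_clinearD(6)[OF C])
  from commutant_comp[OF this U(1)] have "W \<in> commutant C" by (simp add: W_def[abs_def])
  moreover have "is_adjoint W W"
    using U(2) by (simp add: is_adjoint_def W_def cinner_simps)
  moreover have WW: "W (W x) = t *\<^sub>R U (U x)" for x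
    using t by (simp add: W_def bU)
  moreover have tD: "U (U (t *\<^sub>R D x)) = x" for x by (simp add: ZZ[symmetric] UZ)
  then have WWD: "W (W (D x)) = x" for x by (simp add: WW bU)
  moreover have DWW: "D (W (W x)) = x" for x
    by (simp add: WW bD) (simp add: ZZ[symmetric] UZ)
  moreover have "W (D (W x)) = x" for x
    using WWD[of "W x"] DWW[of x] DWW[of "W (D (W x))"] by simp
  ultimately show ?thesis using that by blast
qed

section \<open>Projections in a von Neumann algebra\<close>

locale vN_algebra =
  fixes A :: "('a::chilbert_space \<Rightarrow> 'a) set"
  assumes vN: "von_neumann_algebra A"
begin

lemma A_eq: "commutant (commutant A) = A"
  using vN by (simp add: von_neumann_algebra_def)

lemma bounded_clinear_A: "T \<in> A \<Longrightarrow> bounded_clinear T"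
  using commutantD(1)[of T "commutant A"] by (simp add: A_eq)

lemmas linear_A = bounded_clinearD[OF bounded_clinear_A]

lemma adjoint_A: "T \<in> A \<Longrightarrow> \<exists>T'\<in>A. is_adjoint T T'"
  using vN by (simp add: von_neumann_algebra_def)

lemma comp_A: "S \<in> A \<Longrightarrow> T \<in> A \<Longrightarrow> (\<lambda>x. S (T x)) \<in> A"
  using commutant_comp[of S "commutant A" T] by (simp add: A_eq)

lemma lincomb_A: "S \<in> A \<Longrightarrow> T \<in> A \<Longrightarrow> (\<lambda>x. S x + c *\<^sub>C T x) \<in> A"
  using commutant_lincomb[of S "commutant A" T c, OF _ _ commutantD(1)] by (simp add: A_eq)

lemma id_A: "(\<lambda>x. x) \<in> A"
  using commutant_id[of "commutant A"] by (simp add: A_eq)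

lemma add_A: "S \<in> A \<Longrightarrow> T \<in> A \<Longrightarrow> (\<lambda>x. S x + T x) \<in> A"
  using lincomb_A[of S T 1] by (simp add: scaleR_scaleC[of 1, simplified, symmetric])

lemma diff_A: "S \<in> A \<Longrightarrow> T \<in> A \<Longrightarrow> (\<lambda>x. S x - T x) \<in> A"
  using lincomb_A[of S T "-1"] by (simp add: scaleR_scaleC[of "-1", simplified, symmetric])

lemma diff_scalar_A: "T \<in> A \<Longrightarrow> (\<lambda>x. T x - z *\<^sub>C x) \<in> A"
proof -
  have "(- z) *\<^sub>C x = - (z *\<^sub>C x)" for x :: 'a
    unfolding eq_neg_iff_add_eq_0
    using scaleC_add_left[of "- z" z x] scaleR_scaleC[of 0 x] by simp
  then show "T \<in> A \<Longrightarrow> (\<lambda>x. T x - z *\<^sub>C x) \<in> A"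
    using lincomb_A[OF _ id_A, of T "- z"] by simp
qed

lemma projectionI:
  assumes "P \<in> A" "\<And>x. P (P x) = P x" "is_adjoint P P"
  shows "projection_in A P"
  using assms by (auto simp: projection_in_def)

lemma projectionD:
  assumes "projection_in A P"
  shows "P \<in> A" "P (P x) = P x" "cinner (P x) y = cinner x (P y)" "is_adjoint P P"
proof -
  show "P \<in> A" "cinner (P x) y = cinner x (P y)" "is_adjoint P P"
    using assms by (simp_all add: projection_in_def is_adjoint_def)
  show "P (P x) = P x"
    using assms unfolding projection_in_def by (metis comp_apply)
qed

lemma range_projection: "projection_in A P \<Longrightarrow> x \<in> range P \<longleftrightarrow> P x = x"
  by (metis projectionD(2) rangeE rangeI)

lemma range_compl_projection: "projection_in A P \<Longrightarrow> x \<in> range (compl P) \<longleftrightarrow> P x = 0"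
  by (auto simp: compl_def image_iff linear_A(3) projectionD intro: exI[of _ x])

lemma projection_compl: "projection_in A P \<Longrightarrow> projection_in A (compl P)"
  by (intro projectionI)
    (auto simp: compl_def[abs_def] linear_A(3) projectionD diff_A id_A is_adjoint_def cinner_simps)

section \<open>Polar decomposition of surjections onto a projection\<close>

text \<open>A surjection onto the range of \<open>Q\<close> has an adjoint that is bounded below there: every \<open>z = G x\<close> satisfies
  \<open>\<bar>\<langle>z, y\<rangle>\<bar> \<le> \<parallel>x\<parallel> \<parallel>G\<^sup>* y\<parallel>\<close>, so the functionals \<open>\<langle>\<cdot>, y\<rangle>\<close> with \<open>\<parallel>G\<^sup>* y\<parallel> \<le> 1\<close> are pointwise bounded
  and by Baire's theorem uniformly bounded.\<close>

lemma adjoint_bounded_below: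
  assumes G: "G \<in> A" "G' \<in> A" "is_adjoint G G'"
    and Q: "projection_in A Q" "range G = range Q"
  obtains k where "k > 0" "\<And>y. Q y = y \<Longrightarrow> norm y \<le> k * norm (G' y)"
proof -
  define B where "B = {y. Q y = y \<and> norm (G' y) \<le> 1}"
  define E where "E n = (\<Inter>y\<in>B. {z. cmod (cinner z y) \<le> real n})" for n
  have closed: "closed (E n)" for n
    unfolding E_def
    by (intro closed_INT ballI closed_Collect_le continuous_intros
        bounded_linear.continuous_on[OF bounded_linear_cinner_left])
  \<comment> \<open>Vectors of \<open>B\<close> lie in the range of \<open>Q\<close>, so \<open>z\<close> may be replaced by \<open>Q z = G x\<close>.\<close>
  have cover: "(\<Union>n. E n) = UNIV"
  proof -
    have "\<exists>n. z \<in> E n" for z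
    proof -
      obtain x where x: "Q z = G x" using Q(2) by blast
      obtain n where n: "norm x \<le> real n" using real_arch_simple by blast
      have "cmod (cinner z y) \<le> real n" if y: "y \<in> B" for y
      proof -
        have "cinner z y = cinner (Q z) y"
          using y projectionD(3)[OF Q(1)] by (simp add: B_def)
        also have "\<dots> = cinner x (G' y)" using G(3) by (simp add: x is_adjoint_def)
        finally have "cmod (cinner z y) \<le> norm x * norm (G' y)"
          by (simp add: Cauchy_Schwarz_cinner)
        also have "\<dots> \<le> norm x" using y by (simp add: B_def mult_left_le)
        finally show ?thesis using n by simp
      qed
      then show ?thesis by (auto simp: E_def)
    qed
    then show ?thesis by blast
  qed
  have "\<exists>n. interior (E n) \<noteq> {}"
  proof (rule ccontr)
    assume "\<not> ?thesis"
    then have "euclidean interior_of \<Union>(range E) = {}"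
      using closed
      by (intro Baire_category_alt) (auto simp: completely_metrizable_space_euclidean)
    then show False by (simp add: cover)
  qed
  then obtain n z0 where "z0 \<in> interior (E n)" by blast
  then obtain e where e: "e > 0" "ball z0 e \<subseteq> E n" by (auto simp: mem_interior)
  have unit: "norm y \<le> 4 * real n / e" if y: "y \<in> B" for y
  proof (cases "y = 0")
    case False
    \<comment> \<open>A vector of the ball that differs from its centre by \<open>e / 2\<close> in the direction of \<open>y\<close>.\<close>
    define z where "z = z0 + (e / 2 / norm y) *\<^sub>R y"
    have "z \<in> E n" "z0 \<in> E n" using e False by (auto simp: z_def dist_norm)
    then have "cmod (cinner z y) \<le> n" "cmod (cinner z0 y) \<le> n"
      using y by (auto simp: E_def)
    moreover have "cinner z y - cinner z0 y = complex_of_real (e / 2 * norm y)"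
      using False by (simp add: z_def cinner_simps cinner_self power2_eq_square)
    ultimately have "cmod (complex_of_real (e / 2 * norm y)) \<le> real n + real n"
      by (metis norm_triangle_le_diff add_mono)
    then have "e / 2 * norm y \<le> 2 * real n"
      unfolding norm_of_real using e(1) by simp
    then show ?thesis using e(1) by (simp add: field_simps)
  qed (use e(1) in simp)
  define k where "k = 4 * real n / e + 1"
  have "norm y \<le> k * norm (G' y)" if y: "Q y = y" for y
  proof (cases "G' y = 0")
    case True
    obtain x where "y = G x" using Q(2) y by (metis rangeE rangeI)
    then have "cinner y y = cinner x (G' y)" using G(3) by (metis is_adjoint_def)
    then show ?thesis using True by (simp add: cinner_self)
  next
    case False
    define u where "u = (1 / norm (G' y)) *\<^sub>R y"
    have "u \<in> B" using False y
      by (simp add: B_def u_def linear_A(6)[OF G(2)] linear_A(6)[OF projectionD(1)[OF Q(1)]])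
    from unit[OF this] have "norm u \<le> k" by (simp add: k_def)
    then show ?thesis using False by (simp add: u_def field_simps)
  qed
  moreover have "k > 0" using e(1) by (simp add: k_def add_nonneg_pos)
  ultimately show ?thesis using that by blast
qed

text \<open>The polar decomposition of a surjection \<open>G\<close> onto the range of \<open>Q\<close>: with \<open>W = (G G\<^sup>* + I - Q)\<^sup>-\<^sup>1\<^sup>/\<^sup>2\<close>, the
  operator \<open>W G\<close> is a partial isometry with final projection \<open>Q\<close>, whose initial projection is
  \<open>L G\<close> for the right inverse \<open>L = G\<^sup>* W\<^sup>2\<close> of \<open>G\<close>.\<close>

lemma surjection_right_inverse:
  assumes G: "G \<in> A" and Q: "projection_in A Q" "range G = range Q"
  obtains L where "L \<in> A" "\<And>x. G (L x) = Q x"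
    "projection_in A (\<lambda>x. L (G x))" "mvn_equivalent A (\<lambda>x. L (G x)) Q"
proof -
  obtain G' where G': "G' \<in> A" "is_adjoint G G'" using adjoint_A[OF G] by blast
  have adj: "cinner (G x) y = cinner x (G' y)" "cinner (G' x) y = cinner x (G y)" for x y
    using G'(2) is_adjoint_sym[OF G'(2)] by (simp_all add: is_adjoint_def)
  note lG = linear_A[OF G] and lG' = linear_A[OF G'(1)] and pQ = projectionD[OF Q(1)]
  note lQ = linear_A[OF pQ(1)]
  have QG: "Q (G x) = G x" for x using Q(2) range_projection[OF Q(1)] by blast
  have G'Q: "G' (Q x) = G' x" for x
    by (rule cinner_left_eqI) (simp add: adj pQ QG)
  obtain k where k: "k > 0" "\<And>y. Q y = y \<Longrightarrow> norm y \<le> k * norm (G' y)"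
    using adjoint_bounded_below[OF G G' Q] by blast
  define D where "D x = G (G' x) + (x - Q x)" for x
  define C where "C = insert Q (commutant A)"
  have C: "\<And>R. R \<in> C \<Longrightarrow> bounded_clinear R"
    using bounded_clinear_A[OF pQ(1)] by (auto simp: C_def dest: commutantD(1))
  have in_C: "T \<in> commutant C \<longleftrightarrow> T \<in> A \<and> (\<forall>x. T (Q x) = Q (T x))" for T
  proof
    assume T: "T \<in> commutant C"
    have "T \<in> commutant (commutant A)"
      by (rule commutantI) (use commutantD[OF T] in \<open>auto simp: C_def\<close>)
    then show "T \<in> A \<and> (\<forall>x. T (Q x) = Q (T x))"
      using commutantD(2)[OF T] by (auto simp: A_eq C_def)
  next
    assume T: "T \<in> A \<and> (\<forall>x. T (Q x) = Q (T x))"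
    then have "T \<in> commutant (commutant A)" by (simp add: A_eq)
    from commutantD[OF this] T show "T \<in> commutant C"
      unfolding C_def by (intro commutantI) blast+
  qed
  have D: "D \<in> commutant C"
    unfolding in_C
    by (auto simp: D_def[abs_def] QG G'Q lQ pQ lG' lG
        intro!: add_A diff_A id_A comp_A[OF G G'(1)] pQ(1))
  have DD: "is_adjoint D D"
    by (simp add: is_adjoint_def D_def cinner_simps adj pQ)
  \<comment> \<open>\<open>D\<close> respects the splitting by \<open>Q\<close>: it is bounded below by \<open>1 / k\<^sup>2\<close> on \<open>Q\<close> and by \<open>1\<close> on its complement.\<close>
  define c where "c = min (1 / k\<^sup>2) 1"
  have c: "c > 0" "c \<le> 1 / k\<^sup>2" "c \<le> 1" using k(1) by (auto simp: c_def)
  have "c * (norm x)\<^sup>2 \<le> Re (cinner (D x) x)" for x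
  proof -
    have ortho: "cinner (x - Q x) (Q x) = 0" "cinner (Q x) (x - Q x) = 0"
      by (simp_all add: cinner_simps pQ)
    have "cinner x x = cinner (Q x + (x - Q x)) (Q x + (x - Q x))" by simp
    also have "\<dots> = cinner (Q x) (Q x) + cinner (x - Q x) (x - Q x)"
      unfolding cinner_add_left cinner_add_right ortho by simp
    finally have pyth: "(norm x)\<^sup>2 = (norm (Q x))\<^sup>2 + (norm (x - Q x))\<^sup>2"
      unfolding cinner_self of_real_add[symmetric] by (simp only: of_real_eq_iff)
    have "cinner (x - Q x) x = cinner (x - Q x) (x - Q x)"
      by (simp add: cinner_simps pQ)
    then have "cinner (D x) x = cinner (G' x) (G' x) + cinner (x - Q x) (x - Q x)"
      by (simp add: D_def cinner_add_left adj)
    then have DDx: "Re (cinner (D x) x) = (norm (G' x))\<^sup>2 + (norm (x - Q x))\<^sup>2"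
      by (simp add: cinner_self flip: of_real_power)
    have "norm (Q x) \<le> k * norm (G' x)" using k(2)[of "Q x"] by (simp add: pQ G'Q)
    then have "(norm (Q x))\<^sup>2 \<le> k\<^sup>2 * (norm (G' x))\<^sup>2"
      by (metis power_mono norm_ge_zero power_mult_distrib)
    then have "1 / k\<^sup>2 * (norm (Q x))\<^sup>2 \<le> (norm (G' x))\<^sup>2"
      using k(1) by (simp add: field_simps)
    moreover have "c * (norm (Q x))\<^sup>2 \<le> 1 / k\<^sup>2 * (norm (Q x))\<^sup>2"
      by (intro mult_right_mono c) simp
    moreover have "c * (norm (x - Q x))\<^sup>2 \<le> 1 * (norm (x - Q x))\<^sup>2"
      by (intro mult_right_mono c) simp
    ultimately show ?thesis unfolding pyth DDx distrib_left by linarith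
  qed
  then obtain W where W: "W \<in> commutant C" "is_adjoint W W" "\<And>x. W (W (D x)) = x"
      "\<And>x. W (D (W x)) = x" "\<And>x. D (W (W x)) = x"
    using inverse_square_root[OF C D DD c(1)] by blast
  have WA: "W \<in> A" and WQ: "W (Q x) = Q (W x)" for x using W(1) in_C by auto
  note lW = linear_A[OF WA]
  have adjW: "cinner (W x) y = cinner x (W y)" for x y using W(2) by (simp add: is_adjoint_def)
  define L where "L x = G' (W (W x))" for x
  \<comment> \<open>\<open>D\<close> is the identity on the complement of \<open>Q\<close>, hence so is \<open>W\<^sup>2\<close>.\<close>
  have WWc: "W (W (x - Q x)) = x - Q x" for x
  proof -
    have "D (x - Q x) = x - Q x"
      by (simp add: D_def lG' lQ lG G'Q pQ)
    then show ?thesis using W(3)[of "x - Q x"] by simp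
  qed
  have GG': "G (G' x) = D x - (x - Q x)" for x by (simp add: D_def)
  have GL: "G (L x) = Q x" for x
  proof -
    have "G (L x) = D (W (W x)) - (W (W x) - Q (W (W x)))"
      by (simp add: L_def GG')
    also have "\<dots> = x - W (W (x - Q x))" by (simp only: W(5) WQ lW)
    also have "\<dots> = Q x" by (simp only: WWc) simp
    finally show ?thesis .
  qed
  have LA: "L \<in> A"
    unfolding L_def[abs_def] by (rule comp_A[OF G'(1) comp_A[OF WA WA]])
  moreover have "projection_in A (\<lambda>x. L (G x))"
  proof (rule projectionI)
    show "(\<lambda>x. L (G x)) \<in> A" by (rule comp_A[OF LA G])
    show "L (G (L (G x))) = L (G x)" for x by (simp add: GL QG)
    show "is_adjoint (\<lambda>x. L (G x)) (\<lambda>x. L (G x))"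
      by (simp add: is_adjoint_def L_def adj adjW)
  qed
  moreover have "mvn_equivalent A (\<lambda>x. L (G x)) Q"
    unfolding mvn_equivalent_def
  proof (rule bexI[of _ "\<lambda>x. W (G x)"], rule bexI[of _ "\<lambda>x. G' (W x)"], intro conjI)
    show "(\<lambda>x. W (G x)) \<in> A" by (rule comp_A[OF WA G])
    show "(\<lambda>x. G' (W x)) \<in> A" by (rule comp_A[OF G'(1) WA])
    show "is_adjoint (\<lambda>x. W (G x)) (\<lambda>x. G' (W x))"
      by (simp add: is_adjoint_def adj adjW)
    show "(\<lambda>x. G' (W x)) \<circ> (\<lambda>x. W (G x)) = (\<lambda>x. L (G x))"
      by (simp add: fun_eq_iff L_def)
    have "W (G (G' (W x))) = Q x" for x
    proof -
      have "W (G (G' (W x))) = W (D (W x)) - W (W x - Q (W x))"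
        by (simp add: GG' lW)
      also have "\<dots> = x - W (W (x - Q x))" by (simp only: W(4) WQ lW)
      finally show ?thesis by (simp add: WWc)
    qed
    then show "(\<lambda>x. W (G x)) \<circ> (\<lambda>x. G' (W x)) = Q" by (simp add: fun_eq_iff)
  qed
  ultimately show ?thesis using that GL by blast
qed

section \<open>Equivalence of projections\<close>

text \<open>The decomposition says that \<open>Q\<close> maps the range of \<open>P\<close> bijectively onto its own. Hence \<open>Q P\<close> is a
  surjection onto the range of \<open>Q\<close> with the same kernel as \<open>P\<close>, and the initial projection in its
  polar decomposition is \<open>P\<close>.\<close>

lemma complementary_imp_equivalent:
  assumes P: "projection_in A P" and Q: "projection_in A Q"
    and sum: "is_direct_sum (range (compl Q)) (range P)"
  shows "mvn_equivalent A P Q"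
proof -
  note pP = projectionD[OF P] and pQ = projectionD[OF Q]
  note lP = linear_A[OF pP(1)] and lQ = linear_A[OF pQ(1)]
  have "Q z \<in> range (\<lambda>x. Q (P x))" for z
  proof -
    have "z \<in> {x + y |x y. x \<in> range (compl Q) \<and> y \<in> range P}"
      using sum by (simp add: is_direct_sum_def)
    then obtain x y where "z = x + y" "Q x = 0" "P y = y"
      using range_projection[OF P] range_compl_projection[OF Q] by blast
    then show ?thesis by (auto simp: lQ intro!: image_eqI[of _ _ y])
  qed
  then have "range (\<lambda>x. Q (P x)) = range Q" by auto
  then obtain L where L: "L \<in> A" "\<And>x. Q (P (L x)) = Q x"
      "projection_in A (\<lambda>x. L (Q (P x)))" "mvn_equivalent A (\<lambda>x. L (Q (P x))) Q"
    using surjection_right_inverse[OF comp_A[OF pQ(1) pP(1)] Q] by blast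
  define E where "E x = L (Q (P x))" for x
  note pE = projectionD[OF L(3), folded E_def]
  have EP: "E (P x) = E x" for x by (simp add: E_def pP)
  have PE: "P (E x) = E x" for x
    by (rule cinner_left_eqI) (simp add: pE pP EP)
  have "P x - E x = 0" for x
  proof -
    have "P (P x - E x) = P x - E x" by (simp add: lP pP PE)
    moreover have "Q (P x - E x) = 0"
    proof -
      have "Q (E x) = Q (P (E x))" by (simp add: PE)
      also have "\<dots> = Q (P x)" by (simp add: E_def L pQ)
      finally show ?thesis by (simp add: lQ)
    qed
    ultimately have "P x - E x \<in> range (compl Q) \<inter> range P"
      using range_projection[OF P] range_compl_projection[OF Q] by blast
    then have "P x - E x \<in> {0}" using sum unfolding is_direct_sum_def by blast
    then show ?thesis by simp
  qed
  then have "E = P" by (simp add: fun_eq_iff)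
  then show ?thesis using L(4) by (simp add: E_def[abs_def])
qed

lemma equivalent_sym: "mvn_equivalent A P Q \<Longrightarrow> mvn_equivalent A Q P"
  unfolding mvn_equivalent_def by (blast dest: is_adjoint_sym)

text \<open>If \<open>U\<close> implements \<open>P \<sim> Q\<close> and \<open>V\<close> implements \<open>P \<sim> P'\<close> with \<open>P' < P\<close>, then \<open>U V U\<^sup>*\<close> implements
  \<open>Q \<sim> U P' U\<^sup>*\<close>, and \<open>U P' U\<^sup>* < Q\<close>.\<close>

lemma finite_projection_equivalent:
  assumes P: "projection_in A P" and eq: "mvn_equivalent A P Q" and fin: "finite_projection A Q"
  shows "finite_projection A P"
  unfolding finite_projection_def
proof (intro conjI P notI)
  assume "\<exists>R. projection_in A R \<and> range R \<subset> range P \<and> mvn_equivalent A P R"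
  then obtain R where R: "projection_in A R" "range R \<subset> range P" "mvn_equivalent A P R" by blast
  have Q: "projection_in A Q" using fin by (simp add: finite_projection_def)
  note pP = projectionD[OF P] and pQ = projectionD[OF Q] and pR = projectionD[OF R(1)]
  obtain U U' where U: "U \<in> A" "U' \<in> A" "is_adjoint U U'" "\<And>x. U' (U x) = P x" "\<And>x. U (U' x) = Q x"
    using eq by (auto simp: mvn_equivalent_def fun_eq_iff)
  obtain V V' where V: "V \<in> A" "V' \<in> A" "is_adjoint V V'" "\<And>x. V' (V x) = P x" "\<And>x. V (V' x) = R x"
    using R(3) by (auto simp: mvn_equivalent_def fun_eq_iff)
  have adj: "cinner (U x) y = cinner x (U' y)" "cinner (U' x) y = cinner x (U y)"
      "cinner (V x) y = cinner x (V' y)" "cinner (V' x) y = cinner x (V y)" for x y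
    using U(3) V(3) is_adjoint_sym[OF U(3)] is_adjoint_sym[OF V(3)]
    by (simp_all add: is_adjoint_def)
  have PR: "P (R x) = R x" for x using R(2) range_projection[OF P] by blast
  have RP: "R (P x) = R x" for x by (rule cinner_left_eqI) (simp add: pP pR PR)
  \<comment> \<open>A partial isometry absorbs its initial and final projections.\<close>
  have absorb: "S x = S (S' (S x))"
    if "S \<in> A" "S' \<in> A" and S: "\<And>x y. cinner (S x) y = cinner x (S' y)"
      and E: "projection_in A E" "\<And>x. S' (S x) = E x" for S S' E x
  proof -
    have "cinner (S (x - E x)) (S (x - E x)) = cinner (x - E x) (E (x - E x))"
      by (simp only: S E(2))
    also have "\<dots> = 0"
      by (simp add: linear_A[OF projectionD(1)[OF E(1)]] projectionD[OF E(1)])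
    finally have "S (x - E x) = 0" by (simp add: cinner_self)
    then have "S x = S (E x)" by (simp add: linear_A[OF \<open>S \<in> A\<close>])
    then show ?thesis unfolding E(2) .
  qed
  note U_absorb = absorb[OF U(1,2) adj(1) P U(4)] and V_absorb = absorb[OF V(1,2) adj(3) P V(4)]
  have UP: "U (P x) = U x" for x by (rule U_absorb[unfolded U(4), symmetric])
  have QU: "Q (U x) = U x" for x by (rule U_absorb[unfolded U(5), symmetric])
  have VP: "V (P x) = V x" for x by (rule V_absorb[unfolded V(4), symmetric])
  have RV: "R (V x) = V x" for x by (rule V_absorb[unfolded V(5), symmetric])
  have PV: "P (V x) = V x" for x by (metis PR RV)
  have V'P: "V' (P x) = V' x" for x by (rule cinner_left_eqI) (simp add: adj pP PV)
  define N where "N x = U (R (U' x))" for x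
  have N: "projection_in A N"
  proof (rule projectionI)
    show "N \<in> A" unfolding N_def[abs_def] by (rule comp_A[OF U(1) comp_A[OF pR(1) U(2)]])
    show "N (N x) = N x" for x by (simp add: N_def U RP PR pR)
    show "is_adjoint N N" by (simp add: is_adjoint_def N_def adj pR)
  qed
  have "range N \<subseteq> range Q"
    using range_projection[OF Q] by (auto simp: N_def QU)
  moreover have "range N \<noteq> range Q"
  proof
    assume "range N = range Q"
    then have NQ: "N (Q x) = Q x" for x using range_projection[OF N] by blast
    have "P x \<in> range R" for x
    proof -
      have NU: "N (U x) = U x" using NQ[of "U x"] by (simp only: QU)
      have "R (P x) = U' (N (Q (U x)))"
        by (simp add: N_def QU U RP PR)
      also have "\<dots> = P x" by (simp only: QU NU U)
      finally show ?thesis by (metis rangeI)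
    qed
    with R(2) show False by blast
  qed
  moreover have "mvn_equivalent A Q N"
    unfolding mvn_equivalent_def
  proof (rule bexI[of _ "\<lambda>x. U (V (U' x))"], rule bexI[of _ "\<lambda>x. U (V' (U' x))"], intro conjI)
    show "(\<lambda>x. U (V (U' x))) \<in> A" by (rule comp_A[OF U(1) comp_A[OF V(1) U(2)]])
    show "(\<lambda>x. U (V' (U' x))) \<in> A" by (rule comp_A[OF U(1) comp_A[OF V(2) U(2)]])
    show "is_adjoint (\<lambda>x. U (V (U' x))) (\<lambda>x. U (V' (U' x)))"
      by (simp add: is_adjoint_def adj)
    show "(\<lambda>x. U (V' (U' x))) \<circ> (\<lambda>x. U (V (U' x))) = Q"
      by (simp add: fun_eq_iff U V'P V UP)
    show "(\<lambda>x. U (V (U' x))) \<circ> (\<lambda>x. U (V' (U' x))) = N"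
      by (simp add: fun_eq_iff U VP V N_def)
  qed
  ultimately show False
    using fin N unfolding finite_projection_def by blast
qed

lemma range_eqI_factorization:
  assumes "\<And>x. g (f x) = f x" "\<And>x. f (h x) = g x"
  shows "range g = range f"
proof (intro equalityI image_subsetI)
  show "g x \<in> range f" for x using rangeI[of f "h x"] by (simp only: assms(2))
  show "f x \<in> range g" for x using rangeI[of g "f x"] by (simp only: assms(1))
qed

text \<open>The adjoint of the idempotent \<open>J\<close> maps onto the orthogonal complement of the kernel of \<open>J\<close>, that
  is, onto the range of \<open>R\<close>; its initial projection is the projection onto the range of \<open>J\<close>.\<close>

lemma range_projection_idempotent:
  assumes J: "J \<in> A" and R: "projection_in A R"
    and RJ: "\<And>x. R (J x) = R x" and JR: "\<And>x. J (R x) = J x"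
  obtains E where "projection_in A E" "range E = range J"
proof -
  obtain J' where J': "J' \<in> A" "is_adjoint J J'" using adjoint_A[OF J] by blast
  have adj: "cinner (J x) y = cinner x (J' y)" "cinner (J' x) y = cinner x (J y)" for x y
    using J'(2) is_adjoint_sym[OF J'(2)] by (simp_all add: is_adjoint_def)
  note pR = projectionD[OF R]
  have "R (J' x) = J' x" for x by (rule cinner_left_eqI) (simp add: adj pR JR)
  moreover have "J' (R x) = R x" for x by (rule cinner_left_eqI) (simp add: adj pR RJ)
  ultimately have "range J' = range R" by (intro range_eqI_factorization)
  then obtain L where L: "L \<in> A" "\<And>x. J' (L x) = R x" "projection_in A (\<lambda>x. L (J' x))"
    using surjection_right_inverse[OF J'(1) R] by blast
  obtain L' where L': "L' \<in> A" "is_adjoint L L'" using adjoint_A[OF L(1)] by blast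
  define E where "E x = L (J' x)" for x
  note pE = projectionD[OF L(3), folded E_def]
  have J'E: "J' (E x) = J' x" for x
    by (simp add: E_def L(2)) (rule cinner_left_eqI, simp add: adj pR JR)
  have EJ: "E (J x) = J x" for x
    by (rule cinner_left_eqI) (simp add: pE adj J'E)
  have JL': "J (L' x) = E x" for x
    by (rule cinner_right_eqI)
      (use pE(3)[of _ x] L'(2) in \<open>simp add: E_def is_adjoint_def adj\<close>)
  have "range E = range J" using EJ JL' by (rule range_eqI_factorization)
  then show ?thesis using that L(3) by (simp add: E_def[abs_def])
qed

section \<open>Surjective compressions\<close>

text \<open>Compress to \<open>R = I - P\<close>. As \<open>P \<le> S\<close>, the range of \<open>R\<close> contains that of \<open>I - S\<close>, which \<open>T\<close> maps onto the
  range of \<open>I - Q\<close>; and \<open>R\<close> maps the latter onto its own range because \<open>P\<close> is a complement of it.\<close>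

lemma KPhi_minus_plus_imp_surjective_compression:
  assumes T: "T \<in> KPhi_minus_plus A"
  obtains R where "projection_in A R" "finite_projection A (compl R)"
    "(\<lambda>x. R (T x)) ` range R = range R"
proof -
  from T obtain P Q S T' where P: "projection_in A P" and Q: "projection_in A Q"
    and S: "projection_in A S"
    and hom: "homeomorphism (range (compl S)) (range (compl Q)) T T'"
    and sum: "is_direct_sum (range (compl Q)) (range P)"
    and PS: "range P \<subseteq> range S" and fin: "finite_projection A Q"
    by (auto simp: KPhi_minus_plus_def)
  note pP = projectionD[OF P] and pS = projectionD[OF S]
  note lP = linear_A[OF pP(1)]
  have "S (P x) = P x" for x using PS range_projection[OF S] by blast
  then have PS': "P (S x) = P x" for x
    by (intro cinner_left_eqI) (simp add: pP pS)
  have "y \<in> (\<lambda>x. compl P (T x)) ` range (compl P)" if "P y = 0" for y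
  proof -
    have "y \<in> {x + y |x y. x \<in> range (compl Q) \<and> y \<in> range P}"
      using sum by (simp add: is_direct_sum_def)
    then obtain a b where ab: "y = a + b" "a \<in> range (compl Q)" "P b = b"
      using range_projection[OF P] by blast
    obtain s where s: "a = T s" "S s = 0"
      using ab(2) homeomorphism_image1[OF hom] range_compl_projection[OF S] by blast
    have "P s = 0" using PS'[of s] by (simp add: s(2) lP)
    then have "s \<in> range (compl P)" using range_compl_projection[OF P] by blast
    moreover have "compl P (T s) = y"
    proof -
      have "P a + b = 0" using that ab(3) by (simp add: ab(1) lP)
      then have "b = - P a" by (simp add: eq_neg_iff_add_eq_0 add.commute)
      then show ?thesis by (simp add: compl_def ab(1) s(1))
    qed
    ultimately show ?thesis by blast
  qed
  then have "(\<lambda>x. compl P (T x)) ` range (compl P) = range (compl P)"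
    using range_compl_projection[OF P] by blast
  moreover have "compl (compl P) = P" by (simp add: compl_def)
  moreover have "finite_projection A P"
    by (rule finite_projection_equivalent[OF P complementary_imp_equivalent[OF P Q sum] fin])
  ultimately show ?thesis using that[of "compl P"] projection_compl[OF P] by simp
qed

text \<open>Let \<open>M\<close> be the right inverse of \<open>B = R T R\<close> and \<open>E = M B\<close> the projection onto the orthogonal complement
  of the kernel of \<open>B\<close>. Then \<open>B\<close>, and so \<open>T\<close>, is an isomorphism from the range of \<open>E\<close> onto its image, and
  this image is complementary to the kernel of \<open>R\<close> because \<open>R\<close> maps it bijectively onto the range
  of \<open>R\<close>. The witnesses for the class are \<open>S = I - E\<close>, \<open>P = I - R\<close> and \<open>Q = I - F\<close>, where \<open>F\<close> projects onto the
  image.\<close>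

lemma surjective_compression_imp_KPhi_minus_plus:
  assumes T: "T \<in> A" and R: "projection_in A R" and fin: "finite_projection A (compl R)"
    and onto: "(\<lambda>x. R (T x)) ` range R = range R"
  shows "T \<in> KPhi_minus_plus A"
proof -
  note pR = projectionD[OF R] note lR = linear_A[OF pR(1)] and lT = linear_A[OF T]
  define B where "B x = R (T (R x))" for x
  have BA: "B \<in> A" unfolding B_def[abs_def] by (rule comp_A[OF pR(1) comp_A[OF T pR(1)]])
  have "range B = range R" using onto by (simp add: B_def[abs_def] image_image)
  then obtain M where M: "M \<in> A" "\<And>x. B (M x) = R x" "projection_in A (\<lambda>x. M (B x))"
    using surjection_right_inverse[OF BA R] by blast
  define E where "E x = M (B x)" for x
  have E: "projection_in A E" using M(3) by (simp add: E_def[abs_def])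
  note pE = projectionD[OF E] note lE = linear_A[OF pE(1)]
  have ER: "E (R x) = E x" for x by (simp add: E_def B_def pR)
  have RE: "R (E x) = E x" for x by (rule cinner_left_eqI) (simp add: pE pR ER)
  define L where "L x = M (R x)" for x
  have LA: "L \<in> A" unfolding L_def[abs_def] by (rule comp_A[OF M(1) pR(1)])
  note lL = linear_A[OF LA]
  have EL: "E (L x) = L x" for x by (simp add: E_def L_def M(2) pR)
  have RL: "R (L x) = L x" for x by (metis EL RE)
  have LT: "L (T x) = x" if "E x = x" for x
  proof -
    have "R x = x" by (metis RE that)
    then show ?thesis using that by (simp add: E_def L_def B_def)
  qed
  have RTL: "R (T (L x)) = R x" for x
    using M(2)[of "R x"] RL[of x] by (simp add: B_def L_def pR)
  \<comment> \<open>\<open>T L\<close> is the oblique projection onto \<open>T (range E)\<close> along the complement of \<open>R\<close>.\<close>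
  define J where "J x = T (L x)" for x
  have JA: "J \<in> A" unfolding J_def[abs_def] by (rule comp_A[OF T LA])
  have RJ: "R (J x) = R x" and JR: "J (R x) = J x" for x
    by (simp_all add: J_def RTL) (simp add: L_def pR)
  obtain F where F: "projection_in A F" "range F = range J"
    using range_projection_idempotent[OF JA R RJ JR] by blast
  have cc: "compl (compl X) = X" for X :: "'a \<Rightarrow> 'a" by (simp add: compl_def)
  have E_range: "x \<in> range E \<longleftrightarrow> E x = x" for x by (rule range_projection[OF E])
  have "homeomorphism (range E) (range J) T L"
    unfolding homeomorphism_def
  proof (intro conjI ballI)
    show "L (T x) = x" if "x \<in> range E" for x using that LT E_range by blast
    show "T (L y) = y" if "y \<in> range J" for y
      using that LT[OF EL] by (auto simp: J_def)
    show TE: "T ` range E = range J"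
    proof (intro set_eqI iffI)
      fix y assume "y \<in> T ` range E"
      then obtain x where "y = T x" "E x = x" using E_range by blast
      then have "y = J (T x)" using LT by (simp add: J_def)
      then show "y \<in> range J" by blast
    next
      fix y assume "y \<in> range J"
      then obtain z where "y = T (L z)" by (auto simp: J_def)
      then show "y \<in> T ` range E" using EL E_range by blast
    qed
    have "L ` T ` range E = (\<lambda>x. x) ` range E"
      unfolding image_image using LT E_range by (intro image_cong) auto
    then show "L ` range J = range E" by (simp add: TE)
    show "continuous_on (range E) T" "continuous_on (range J) L"
      using lT(1) lL(1) by (simp_all add: linear_continuous_on)
  qed
  moreover have sum: "is_direct_sum (range J) (range (compl R))"
    unfolding is_direct_sum_def
  proof
    have "y = 0" if y: "y \<in> range J" "R y = 0" for y
    proof -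
      obtain z where z: "y = J z" using y(1) by blast
      with y(2) have "R z = 0" by (simp add: RJ)
      then show ?thesis using JR[of z] by (simp add: z linear_A(5)[OF JA])
    qed
    moreover have "0 \<in> range J" by (rule image_eqI[of _ _ 0]) (simp_all add: linear_A(5)[OF JA])
    ultimately show "range J \<inter> range (compl R) = {0}"
      using range_compl_projection[OF R] lR(5) by blast
    have "h \<in> {x + y |x y. x \<in> range J \<and> y \<in> range (compl R)}" for h
    proof -
      have "h = J h + (h - J h)" "R (h - J h) = 0" by (simp_all add: lR RJ)
      then show ?thesis using range_compl_projection[OF R] by blast
    qed
    then show "{x + y |x y. x \<in> range J \<and> y \<in> range (compl R)} = UNIV" by blast
  qed
  moreover have "range (compl R) \<subseteq> range (compl E)"
  proof
    fix y assume "y \<in> range (compl R)"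
    then have "R y = 0" using range_compl_projection[OF R] by blast
    then show "y \<in> range (compl E)"
      using ER[of y] range_compl_projection[OF E] by (simp add: lE)
  qed
  moreover have "finite_projection A (compl F)"
  proof (rule finite_projection_equivalent[OF projection_compl[OF F(1)] _ fin])
    show "mvn_equivalent A (compl F) (compl R)"
      by (rule equivalent_sym, rule complementary_imp_equivalent[OF projection_compl[OF R]
            projection_compl[OF F(1)]])
        (use sum in \<open>simp add: cc F(2)\<close>)
  qed
  ultimately show ?thesis
    unfolding KPhi_minus_plus_def
    using T projection_compl[OF E] projection_compl[OF R] projection_compl[OF F(1)] F(2)
    by (intro CollectI conjI exI[of _ "compl R"] exI[of _ "compl F"] exI[of _ "compl E"] exI[of _ L])
      (simp_all add: cc)
qed

end

theorem corollary4p14: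
  fixes A :: "('a::chilbert_space \<Rightarrow> 'a) set" and F :: "'a \<Rightarrow> 'a"
  assumes "von_neumann_algebra A"
    and "properly_infinite A"
    and "F \<in> A"
  shows "sigma_eD A F =
    (\<Inter>P\<in>{P. projection_in A P \<and> finite_projection A (compl P)}. sigma_d_compression P F)"
proof (rule set_eqI)
  interpret vN_algebra A by unfold_locales (rule assms(1))
  fix z
  define T where "T x = F x - z *\<^sub>C x" for x
  have T: "T \<in> A" unfolding T_def[abs_def] by (rule diff_scalar_A[OF assms(3)])
  have compression: "z \<in> sigma_d_compression P F \<longleftrightarrow> (\<lambda>x. P (T x)) ` range P \<noteq> range P"
    if P: "projection_in A P" for P
  proof -
    have "P (T x) = P (F x) - z *\<^sub>C x" if "x \<in> range P" for x
      using that range_projection[OF P] linear_A[OF projectionD(1)[OF P]] by (simp add: T_def)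
    then have "(\<lambda>x. P (T x)) ` range P = (\<lambda>x. P (F x) - z *\<^sub>C x) ` range P"
      by (intro image_cong refl)
    then show ?thesis by (simp add: sigma_d_compression_def)
  qed
  have "z \<in> sigma_eD A F \<longleftrightarrow> T \<notin> KPhi_minus_plus A"
    by (simp add: sigma_eD_def T_def[abs_def])
  also have "\<dots> \<longleftrightarrow> \<not> (\<exists>P. projection_in A P \<and> finite_projection A (compl P) \<and>
      (\<lambda>x. P (T x)) ` range P = range P)"
    using KPhi_minus_plus_imp_surjective_compression
      surjective_compression_imp_KPhi_minus_plus[OF T] by metis
  also have "\<dots> \<longleftrightarrow>
      z \<in> (\<Inter>P\<in>{P. projection_in A P \<and> finite_projection A (compl P)}. sigma_d_compression P F)"
    using compression by blast
  finally show "z \<in> sigma_eD A F \<longleftrightarrow>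
      z \<in> (\<Inter>P\<in>{P. projection_in A P \<and> finite_projection A (compl P)}. sigma_d_compression P F)" .
qed

end
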